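(* Consider any $N\times N$ matrices $\underline\sigma_{i+1/2}$ ($i\in\mathbb{Z}$) such that $I+\underline\sigma_{i+1/2}$ and $\big(1+\frac{\Delta x}{2\varepsilon b}\big)I+\underline\sigma_{i+1/2}$ are nonsingular for all $\varepsilon>0$. Assume the existence of $n\times n$ matrices $\mathcal{M}_{i+1/2}$ such that $$Q\,(I+\underline\sigma_{i+1/2})^{-1}=\frac1{b^2}\,\mathcal{M}_{i+1/2}\,Q ,$$ and introduce the $n\times n$ matrix $$\mathcal{M}(u)=Q\,A(\mathcal{E}(u))\,\mathcal{L}^{-1}(u)\,D^2_U\Phi(\mathcal{E}(u))\,A(\mathcal{E}(u))\,D_u\mathcal{E}(u).$$ In addition, assume that $\mathcal{M}_{i+1/2}$ is a discrete form of $\mathcal{M}(u)$ at each cell interface $x_{i+1/2}$. Then the asymptotic behavior, as $\varepsilon\to0$ with $\Delta t,\Delta x$ fixed, of the scheme $$\frac{\varepsilon}{\Delta t}(U_i^{n+1}-U_i^n)+\frac{\varepsilon}{\Delta x}\big(\underline\alpha^\varepsilon_{i+1/2}F^{HLL}_{i+1/2}-\underline\alpha^\varepsilon_{i-1/2}F^{HLL}_{i-1/2}\big)=\frac{\varepsilon}{\Delta x}\big(\underline\alpha^\varepsilon_{i+1/2}-\underline\alpha^\varepsilon_{i-1/2}\big)F(U_i^n)-\frac12\big(\underline\alpha^\varepsilon_{i+1/2}+\underline\alpha^\varepsilon_{i-1/2}\big)R(U_i^n)$$ coincides with a discrete form of the limit diffusion equation $$\partial_tu=\partial_x\Big(S\,\mathcal{L}^{-1}(u)\,S^T\big(\partial_xD_u\Phi(\mathcal{E}(u))\big)^T\Big),\qquad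 S:=QA(\mathcal{E}(u)).$$ That is, if the scheme's solutions admit expansions $U_i^n=\mathcal{E}(u_i^n)+\varepsilon(U_1)_i^n+\mathcal{O}(\varepsilon^2)$ for all $i,n$, then the leading-order states satisfy $$\frac1{\Delta t}(u_i^{n+1}-u_i^n)=\frac1{\Delta x^2}\Big(\mathcal{M}_{i+1/2}(u_{i+1}^n-u_i^n)+\mathcal{M}_{i-1/2}(u_{i-1}^n-u_i^n)\Big),$$ and the limit diffusion equation reads $\partial_tu=\partial_x(\mathcal{M}(u)\partial_xu)$, of which this is a discretization.
   Context: Setting. Let $1\le n<N$, let $\Omega\subset\mathbb{R}^N$ be an open convex set, $F,R:\Omega\to\mathbb{R}^N$ smooth. The system under study is $\varepsilon\,\partial_tU+\partial_xF(U)=-R(U)/\varepsilon$, $U\in\Omega$, $\varepsilon>0$. Write $A:=D_UF$, $B:=D_UR$; $A(U)$ has real eigenvalues and a full basis of eigenvectors. Assumptions: (1) $Q$ is a constant $n\times N$ matrix of rank $n$ with $QR(U)=0$ on $\Omega$; $\omega:=Q\Omega$. (2) $\mathcal{E}:\omega\to\Omega$ is smooth and uniquely determines the local equilibria: $Q\mathcal{E}(u)=u$, $R(\mathcal{E}(u))=0$ for $u\in\omega$. (3) For $u\in\omega$: $\dim\ker B(\mathcal{E}(u))=n$, $\ker B(\mathcal{E}(u))\cap\operatorname{Im}B(\mathcal{E}(u))=\{0\}$. (4) $QF(\mathcal{E}(u))=0$ for $u\in\omega$. (5) $\Phi:\Omega\to\mathbb{R}$ is a smooth entropy with $D_U^2\Phi(U)$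 positive definite and $D_U^2\Phi(U)A(U)$ symmetric, with entropy flux $\Psi$, $D_U\Phi\,A=D_U\Psi$ (first derivatives are row vectors), satisfying $D_U\Phi(U)R(U)\ge0$ on $\Omega$ and $D_U\Phi(\mathcal{E}(u))=\nu(\mathcal{E}(u))Q$ for some $\mathbb{R}^n$-valued (row-vector) map $\nu$ defined on the equilibrium manifold $\{\mathcal{E}(u):u\in\omega\}$. Notation: $\mathcal{L}(u):=D_U^2\Phi(\mathcal{E}(u))B(\mathcal{E}(u))$; for $y\in\mathbb{R}^N$ with $Q(D_U^2\Phi(\mathcal{E}(u)))^{-1}y=0$, $\mathcal{L}^{-1}(u)y$ is the unique $V\in\mathbb{R}^N$ with $\mathcal{L}(u)V=y$, $QV=0$ (applied column by column to matrices). $D_u\Phi(\mathcal{E}(u))$ is the row-vector gradient in $u$ of $u\mapsto\Phi(\mathcal{E}(u))$. Scheme: uniform mesh of size $\Delta x$ with interfaces $x_{i+1/2}$, time step $\Delta t$, constant $b>0$, cell values $U_i^n\in\Omega$, $$F^{HLL}_{i+1/2}=\tfrac12\big(F(U_i^n)+F(U_{i+1}^n)\big)-\tfrac b2(U_{i+1}^n-U_i^n),\qquad \underline\alpha^\varepsilon_{i+1/2}=\Big(\varepsilon I+\frac{\Delta x}{2b}(I+\underline\sigma_{i+1/2})\Big)^{-1},$$ $I$ the $N\times N$ identity. In the expansion in $\varepsilon$, the parameter matrices $\underline\sigma_{i+1/2}$ are not expanded (treated as independent of $\varepsilon$). "$\mathcal{M}_{i+1/2}$ is a discrete form of $\mathcal{M}(u)$"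 means it is a consistent approximation, in terms of the discrete values $u_i^n$, of $\mathcal{M}(u)$ at $x_{i+1/2}$. *)

theory Defs
  imports "HOL-Analysis.Analysis" "HOL-Library.Landau_Symbols"
begin

text \<open>Smoothness (all iterated directional derivatives exist and are continuous), meant for
  open \<open>S\<close>.\<close>

primrec Ck_on :: "nat \<Rightarrow> 'a::real_normed_vector set \<Rightarrow> ('a \<Rightarrow> 'b::real_normed_vector) \<Rightarrow> bool" where
  "Ck_on 0 S f \<longleftrightarrow> continuous_on S f"
| "Ck_on (Suc k) S f \<longleftrightarrow>
     (\<forall>x\<in>S. f differentiable (at x)) \<and> (\<forall>v. Ck_on k S (\<lambda>x. frechet_derivative f (at x) v))"

definition smooth_on :: "'a::real_normed_vector set \<Rightarrow> ('a \<Rightarrow> 'b::real_normed_vector) \<Rightarrow> bool" where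
  "smooth_on S f \<longleftrightarrow> (\<forall>k. Ck_on k S f)"

abbreviation Jac :: "(real^'a \<Rightarrow> real^'b) \<Rightarrow> real^'a \<Rightarrow> real^'a^'b" where
  "Jac f x \<equiv> jacobian f (at x)"

text \<open>First derivatives of scalar functions are row vectors; they multiply matrices from the left
  by \<open>v*\<close>.\<close>

definition grad :: "(real^'a \<Rightarrow> real) \<Rightarrow> real^'a \<Rightarrow> real^'a" where
  "grad f x = (\<chi> j. frechet_derivative f (at x) (axis j 1))"

definition hess :: "(real^'a \<Rightarrow> real) \<Rightarrow> real^'a \<Rightarrow> real^'a^'a" where
  "hess f x = Jac (grad f) x"

definition symmetric_matrix :: "real^'a^'a \<Rightarrow> bool" where
  "symmetric_matrix M \<longleftrightarrow> transpose M = M"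

definition pos_def_matrix :: "real^'a^'a \<Rightarrow> bool" where
  "pos_def_matrix M \<longleftrightarrow> symmetric_matrix M \<and> (\<forall>x. x \<noteq> 0 \<longrightarrow> 0 < x \<bullet> (M *v x))"

text \<open>A basis of real eigenvectors; this forces all complex eigenvalues to be real.\<close>

definition real_eigenbasis :: "real^'a^'a \<Rightarrow> bool" where
  "real_eigenbasis M \<longleftrightarrow>
     (\<exists>V. independent V \<and> span V = UNIV \<and> (\<forall>v\<in>V. \<exists>c::real. M *v v = c *\<^sub>R v))"


definition Lop ::
  "(real^'N \<Rightarrow> real) \<Rightarrow> (real^'N \<Rightarrow> real^'N) \<Rightarrow> (real^'n \<Rightarrow> real^'N) \<Rightarrow> real^'n \<Rightarrow> real^'N^'N" where
  "Lop \<Phi> R E u = hess \<Phi> (E u) ** Jac R (E u)"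

text \<open>Only meaningful for \<open>y\<close> with \<open>Q *v (matrix_inv (hess \<Phi> (E u)) *v y) = 0\<close>.\<close>

definition Linv ::
  "(real^'N \<Rightarrow> real) \<Rightarrow> (real^'N \<Rightarrow> real^'N) \<Rightarrow> real^'N^'n \<Rightarrow> (real^'n \<Rightarrow> real^'N) \<Rightarrow> real^'n
    \<Rightarrow> real^'N \<Rightarrow> real^'N" where
  "Linv \<Phi> R Q E u y = (THE V. Lop \<Phi> R E u *v V = y \<and> Q *v V = 0)"

definition Linv_mat ::
  "(real^'N \<Rightarrow> real) \<Rightarrow> (real^'N \<Rightarrow> real^'N) \<Rightarrow> real^'N^'n \<Rightarrow> (real^'n \<Rightarrow> real^'N) \<Rightarrow> real^'n
    \<Rightarrow> real^'k^'N \<Rightarrow> real^'k^'N" where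
  "Linv_mat \<Phi> R Q E u Y = (\<chi> i j. Linv \<Phi> R Q E u (column j Y) $ i)"

definition diffusion_matrix ::
  "(real^'N \<Rightarrow> real) \<Rightarrow> (real^'N \<Rightarrow> real^'N) \<Rightarrow> (real^'N \<Rightarrow> real^'N) \<Rightarrow> real^'N^'n
    \<Rightarrow> (real^'n \<Rightarrow> real^'N) \<Rightarrow> real^'n \<Rightarrow> real^'n^'n" where
  "diffusion_matrix \<Phi> F R Q E u =
     Q ** Jac F (E u) ** Linv_mat \<Phi> R Q E u (hess \<Phi> (E u) ** Jac F (E u) ** Jac E u)"

definition S_mat ::
  "(real^'N \<Rightarrow> real^'N) \<Rightarrow> real^'N^'n \<Rightarrow> (real^'n \<Rightarrow> real^'N) \<Rightarrow> real^'n \<Rightarrow> real^'N^'n" where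
  "S_mat F Q E u = Q ** Jac F (E u)"

text \<open>The flux \<open>S L\<inverse>(u) S\<^sup>T (\<partial>\<^sub>x D\<^sub>u\<Phi>(E(u)))\<^sup>T\<close> of a spatial profile \<open>w\<close>, at the point \<open>x\<close>.\<close>

definition limit_flux ::
  "(real^'N \<Rightarrow> real) \<Rightarrow> (real^'N \<Rightarrow> real^'N) \<Rightarrow> (real^'N \<Rightarrow> real^'N) \<Rightarrow> real^'N^'n
    \<Rightarrow> (real^'n \<Rightarrow> real^'N) \<Rightarrow> (real \<Rightarrow> real^'n) \<Rightarrow> real \<Rightarrow> real^'n" where
  "limit_flux \<Phi> F R Q E w x =
     (S_mat F Q E (w x) ** Linv_mat \<Phi> R Q E (w x) (transpose (S_mat F Q E (w x))))
       *v vector_derivative (\<lambda>y. grad (\<lambda>u. \<Phi> (E u)) (w y)) (at x)"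

text \<open>\<open>v\<close> satisfies \<open>\<partial>\<^sub>t v = \<partial>\<^sub>x (flux of v)\<close> on the space-time set \<open>D\<close>; points are pairs \<open>(t, x)\<close>.\<close>

definition solves_flux_eq ::
  "((real \<Rightarrow> real^'n) \<Rightarrow> real \<Rightarrow> real^'n) \<Rightarrow> (real \<times> real) set \<Rightarrow> (real \<times> real \<Rightarrow> real^'n) \<Rightarrow> bool" where
  "solves_flux_eq g D v \<longleftrightarrow>
     (\<forall>(t, x)\<in>D. \<exists>d. ((\<lambda>s. v (s, x)) has_vector_derivative d) (at t) \<and>
                     ((\<lambda>y. g (\<lambda>z. v (t, z)) y) has_vector_derivative d) (at x))"


text \<open>Quantities at the interface \<open>x\<^bsub>i+1/2\<^esub>\<close> carry the index \<open>i\<close>.\<close>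

definition F_HLL :: "(real^'N \<Rightarrow> real^'N) \<Rightarrow> real \<Rightarrow> (int \<Rightarrow> real^'N) \<Rightarrow> int \<Rightarrow> real^'N" where
  "F_HLL F b U i = (1/2) *\<^sub>R (F (U i) + F (U (i + 1))) - (b/2) *\<^sub>R (U (i + 1) - U i)"

definition alpha_mat :: "real \<Rightarrow> real \<Rightarrow> real \<Rightarrow> real^'N^'N \<Rightarrow> real^'N^'N" where
  "alpha_mat b dx \<epsilon> sig = matrix_inv (mat \<epsilon> + (dx / (2 * b)) *\<^sub>R (mat 1 + sig))"

text \<open>One time step of the scheme in cell \<open>i\<close>, from the states \<open>U\<close> to the states \<open>U'\<close>.\<close>

definition scheme_step ::
  "(real^'N \<Rightarrow> real^'N) \<Rightarrow> (real^'N \<Rightarrow> real^'N) \<Rightarrow> real \<Rightarrow> real \<Rightarrow> real \<Rightarrow> real \<Rightarrow> (int \<Rightarrow> real^'N^'N)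
    \<Rightarrow> (int \<Rightarrow> real^'N) \<Rightarrow> (int \<Rightarrow> real^'N) \<Rightarrow> int \<Rightarrow> bool" where
  "scheme_step F R b dx dt \<epsilon> sig U U' i \<longleftrightarrow>
     (let ap = alpha_mat b dx \<epsilon> (sig i); am = alpha_mat b dx \<epsilon> (sig (i - 1)) in
      (\<epsilon> / dt) *\<^sub>R (U' i - U i)
        + (\<epsilon> / dx) *\<^sub>R (ap *v F_HLL F b U i - am *v F_HLL F b U (i - 1))
      = (\<epsilon> / dx) *\<^sub>R ((ap - am) *v F (U i)) - (1/2) *\<^sub>R ((ap + am) *v R (U i)))"


text \<open>A numerical quantity attached to interfaces is a function of the mesh size \<open>h\<close> and of the cell
  values listed relative to the interface: offset \<open>0\<close> is the cell to its left, offset \<open>1\<close> the cell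
  to its right, so the cell with offset \<open>j\<close> has its centre at distance \<open>(j - 1/2) h\<close> from the
  interface. It is consistent with a continuous quantity \<open>q\<close> (a function of the profile and of the
  position) if, on the cell-centre values of any smooth \<open>\<omega>\<close>-valued profile, it converges to \<open>q\<close> at
  the interface, uniformly for interfaces in bounded intervals.\<close>

definition discrete_form ::
  "(real^'n) set \<Rightarrow> (real \<Rightarrow> (int \<Rightarrow> real^'n) \<Rightarrow> 'b::metric_space)
    \<Rightarrow> ((real \<Rightarrow> real^'n) \<Rightarrow> real \<Rightarrow> 'b) \<Rightarrow> bool" where
  "discrete_form \<omega> qnum q \<longleftrightarrow>
     (\<forall>w. smooth_on UNIV w \<and> range w \<subseteq> \<omega> \<longrightarrow>
        (\<forall>a b. uniform_limit {a..b}
           (\<lambda>h x. qnum h (\<lambda>j. w (x + (of_int j - 1/2) * h))) (q w) (at_right 0)))"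

text \<open>The grid function \<open>u\<close> is given by a discrete form of \<open>\<partial>\<^sub>t u = \<partial>\<^sub>x (flux of u)\<close> in the
  finite-volume sense: explicit Euler in time, conservative in space, with a numerical flux
  that is a discrete form of the flux.\<close>

definition discrete_form_of_flux_eq ::
  "(real^'n) set \<Rightarrow> (real \<Rightarrow> (int \<Rightarrow> real^'n) \<Rightarrow> real^'n) \<Rightarrow> ((real \<Rightarrow> real^'n) \<Rightarrow> real \<Rightarrow> real^'n)
    \<Rightarrow> real \<Rightarrow> real \<Rightarrow> (nat \<Rightarrow> int \<Rightarrow> real^'n) \<Rightarrow> bool" where
  "discrete_form_of_flux_eq \<omega> gnum g dx dt u \<longleftrightarrow>
     discrete_form \<omega> gnum g \<and>
     (\<forall>n i. (1/dt) *\<^sub>R (u (Suc n) i - u n i) =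
            (1/dx) *\<^sub>R (gnum dx (\<lambda>j. u n (i + j)) - gnum dx (\<lambda>j. u n (i - 1 + j))))"

end

theory Submission
  imports Defs
begin

text \<open>
  Write \<open>A\<close>, \<open>B\<close>, \<open>H\<close> for the Jacobians of \<open>F\<close>, \<open>R\<close> and the Hessian of \<open>\<Phi>\<close> at an equilibrium
  \<open>E(u)\<close>, and \<open>D\<close> for the differential of \<open>E\<close> at \<open>u\<close>. The equations \<open>Q R = 0\<close> on \<open>\<Omega>\<close> and
  \<open>Q E(u) = u\<close>, \<open>R(E(u)) = 0\<close>, \<open>Q F(E(u)) = 0\<close> on \<open>\<omega>\<close> hold on open sets, and differentiating
  them gives \<open>Q B = 0\<close>, \<open>Q D = 1\<close>, \<open>B D = 0\<close> and \<open>Q A D = 0\<close>.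

  The scheme. As \<open>\<epsilon> \<rightarrow> 0\<close> the matrices \<open>\<alpha>\<close> tend to \<open>(2b/\<Delta>x) (I + \<sigma>)\<inverse>\<close> and \<open>R(U)/\<epsilon>\<close> tends to
  \<open>B U\<^sub>1\<close>, so the scheme divided by \<open>\<epsilon>\<close> has a limit. Multiplying the limit by \<open>Q\<close> and using
  \<open>Q (I + \<sigma>)\<inverse> = M Q / b\<^sup>2\<close> eliminates every term that contains \<open>F\<close> or \<open>U\<^sub>1\<close>; only the numerical viscosity
  of the HLL flux survives, and it is the three-point diffusion operator (\<open>scheme_limit\<close>).

  The limit equation. By \<open>B D = 0\<close>, \<open>Q D = 1\<close> and a dimension count \<open>ker B = Im D\<close>, which meets
  \<open>ker Q\<close> only in \<open>0\<close>. Therefore \<open>C = B + Q\<^sup>T Q\<close> is invertible and \<open>L\<inverse> y = C\<inverse> H\<inverse> y\<close> for every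
  admissible \<open>y\<close> (\<open>constrained_inverse\<close>). The entropy variables \<open>\<eta> = D\<^sub>u(\<Phi> \<circ> E)\<close> satisfy
  \<open>Q\<^sup>T \<eta>(u) = D\<^sub>U\<Phi>(E(u))\<close>, whose derivative is \<open>Q\<^sup>T D\<eta> = H D\<close>. Together with the symmetry of \<open>H\<close> and \<open>H A\<close>
  this yields \<open>S\<^sup>T D\<eta> = H A D\<close>, that is, \<open>S L\<inverse> S\<^sup>T \<partial>\<^sub>x\<eta> = Q A L\<inverse> H A D \<partial>\<^sub>xu = M(u) \<partial>\<^sub>xu\<close>
  (\<open>limit_flux_eq\<close>).

  Consistency. The numerical flux is the product of the interface matrix, which converges uniformly
  by assumption, and a centred difference quotient, which converges uniformly for smooth profiles.
  The product converges uniformly because both limits are bounded on compact intervals; for the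
  matrix this follows from its continuity, which the formula \<open>M(u) = Q A C\<inverse> A D\<close> shows
  (\<open>discrete_form_flux\<close>).
\<close>

section \<open>Matrix algebra and continuity of the inverse\<close>

lemma bounded_bilinear_matrix_vector_mult:
  "bounded_bilinear ((*v) :: real^'n^'m \<Rightarrow> real^'n \<Rightarrow> real^'m)"
  unfolding bilinear_conv_bounded_bilinear[symmetric] bilinear_def
  by (auto intro!: linearI simp: algebra_simps scaleR_matrix_vector_assoc[symmetric]
      matrix_vector_mult_scaleR)

lemma matrix_add_rdistrib: "(A + B) ** C = A ** C + B ** (C :: real^'k^'n)"
  by (simp add: matrix_eq matrix_vector_mul_assoc[symmetric] matrix_vector_mult_add_rdistrib)

lemma bounded_bilinear_matrix_matrix_mult:
  "bounded_bilinear ((**) :: real^'n^'m \<Rightarrow> real^'k^'n \<Rightarrow> real^'k^'m)"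
  unfolding bilinear_conv_bounded_bilinear[symmetric] bilinear_def
  by (auto intro!: linearI simp: algebra_simps scalar_matrix_assoc matrix_scalar_ac
      matrix_add_ldistrib matrix_add_rdistrib)

lemma matrix_inv:
  assumes "invertible (A::real^'n^'n)"
  shows matrix_inv_right: "A ** matrix_inv A = mat 1" and matrix_inv_left: "matrix_inv A ** A = mat 1"
  using assms someI_ex[of "\<lambda>B. A ** B = mat 1 \<and> B ** A = mat 1"]
  unfolding invertible_def matrix_inv_def by auto

lemma matrix_inv_unique:
  assumes "A ** B = mat 1" "B ** (A::real^'n^'n) = mat 1"
  shows "matrix_inv A = B"
  by (metis assms invertible_def matrix_inv_left matrix_mul_assoc matrix_mul_lid matrix_mul_rid)

text \<open>Cramer's rule for the unit vectors: the entries of the inverse are quotients of determinants,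
  so the inverse depends continuously on the matrix.\<close>

lemma matrix_inv_cramer:
  fixes A :: "real^'n^'n"
  assumes "det A \<noteq> 0"
  shows "matrix_inv A =
    (\<chi> k l. det (\<chi> i j. if j = k then axis l 1 $ i else A $ i $ j) / det A)"
proof -
  have "A *v column l (matrix_inv A) = axis l 1" for l
    by (metis assms invertible_det_nz matrix_inv_right matrix_vector_mul_assoc
        matrix_vector_mul_lid matrix_vector_mult_basis)
  then show ?thesis
    using cramer[OF assms] by (auto simp: vec_eq_iff column_def)
qed

lemma tendsto_matrix_inv:
  fixes A :: "'a \<Rightarrow> real^'n^'n"
  assumes A: "(A \<longlongrightarrow> A0) F" and inv: "invertible A0"
  shows "((\<lambda>x. matrix_inv (A x)) \<longlongrightarrow> matrix_inv A0) F"
proof -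
  have nz: "det A0 \<noteq> 0" using inv by (simp add: invertible_det_nz)
  have det: "((\<lambda>x. det (C x)) \<longlongrightarrow> det C0) F"
    if "\<And>i j. ((\<lambda>x. C x $ i $ j) \<longlongrightarrow> C0 $ i $ j) F" for C :: "'a \<Rightarrow> real^'n^'n" and C0
    unfolding det_def by (intro tendsto_intros that)
  have d: "((\<lambda>x. det (A x)) \<longlongrightarrow> det A0) F" by (intro det tendsto_intros A)
  have "((\<lambda>x. \<chi> k l. det (\<chi> i j. if j = k then axis l 1 $ i else A x $ i $ j) / det (A x)) \<longlongrightarrow>
      (\<chi> k l. det (\<chi> i j. if j = k then axis l 1 $ i else A0 $ i $ j) / det A0)) F"
  proof (intro tendsto_vec_lambda tendsto_divide d nz det)
    fix k l i j
    show "((\<lambda>x. (\<chi> i j. if j = k then axis l 1 $ i else A x $ i $ j) $ i $ j) \<longlongrightarrow>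
      (\<chi> i j. if j = k then axis l 1 $ i else A0 $ i $ j) $ i $ j) F"
      by (cases "j = k") (auto intro!: tendsto_intros A)
  qed
  moreover have "\<forall>\<^sub>F x in F. det (A x) \<noteq> 0"
    using tendsto_imp_eventually_ne[OF d nz] .
  then have "\<forall>\<^sub>F x in F. (\<chi> k l. det (\<chi> i j. if j = k then axis l 1 $ i else A x $ i $ j) / det (A x))
      = matrix_inv (A x)"
    by (rule eventually_mono) (simp add: matrix_inv_cramer)
  ultimately show ?thesis
    unfolding matrix_inv_cramer[OF nz] by (rule Lim_transform_eventually)
qed

lemma injective_imp_invertible:
  assumes "\<And>x. (A::real^'n^'n) *v x = 0 \<Longrightarrow> x = 0"
  shows "invertible A"
  using assms invertible_left_inverse matrix_left_invertible_ker by blast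

lemma continuous_on_matrix_inv:
  fixes A :: "'a::topological_space \<Rightarrow> real^'n^'n"
  assumes "continuous_on S A" "\<And>x. x \<in> S \<Longrightarrow> invertible (A x)"
  shows "continuous_on S (\<lambda>x. matrix_inv (A x))"
  using assms by (auto simp: continuous_on_def intro!: tendsto_matrix_inv)

lemma matrix_inv_scaleR:
  assumes "c \<noteq> 0" "invertible (X::real^'n^'n)"
  shows "matrix_inv (c *\<^sub>R X) = (1/c) *\<^sub>R matrix_inv X"
proof (rule matrix_inv_unique)
  have mult: "(a *\<^sub>R Y) ** (b *\<^sub>R Z) = (b * a) *\<^sub>R (Y ** Z)" for a b and Y Z :: "real^'n^'n"
    by (simp only: matrix_scalar_ac scalar_matrix_assoc[symmetric] scaleR_scaleR)
  show "(c *\<^sub>R X) ** ((1/c) *\<^sub>R matrix_inv X) = mat 1"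
    "((1/c) *\<^sub>R matrix_inv X) ** (c *\<^sub>R X) = mat 1"
    using assms by (simp_all only: mult matrix_inv) simp_all
qed

text \<open>The constraint \<open>Q V = 0\<close> makes the singular system \<open>B V = z\<close> uniquely solvable, and adding
  \<open>Q\<^sup>T Q\<close> turns the pair of equations into one invertible system. The matrix \<open>D\<close> (the differential
  of the equilibrium map in the application) supplies a basis of \<open>ker B\<close> on which \<open>Q\<close> is
  injective, so \<open>ker B \<inter> ker Q = 0\<close>. Applying \<open>Q\<close> to \<open>B V + Q\<^sup>T Q V = z\<close> with \<open>Q z = 0\<close> leaves
  \<open>Q Q\<^sup>T (Q V) = 0\<close>, hence \<open>Q V = 0\<close>, because \<open>D\<^sup>T\<close> is a left inverse of \<open>Q\<^sup>T\<close>.\<close>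

lemma constrained_inverse:
  fixes B :: "real^'N^'N" and Q :: "real^'N^'n" and D :: "real^'n^'N"
  assumes QB: "Q ** B = 0" and BD: "B ** D = 0" and QD: "Q ** D = mat 1"
    and ker: "dim {V. B *v V = 0} = CARD('n)"
  shows "invertible (B + transpose Q ** Q)"
    and "Q *v z = 0 \<Longrightarrow>
      B *v V = z \<and> Q *v V = 0 \<longleftrightarrow> V = matrix_inv (B + transpose Q ** Q) *v z"
proof -
  let ?C = "B + transpose Q ** Q"
  have QDv: "Q *v (D *v x) = x" for x
    using QD by (simp add: matrix_vector_mul_assoc)
  have QBv: "Q *v (B *v x) = 0" for x
    using QB by (simp add: matrix_vector_mul_assoc)
  have BDv: "B *v (D *v x) = 0" for x
    using BD by (simp add: matrix_vector_mul_assoc)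
  have "inj ((*v) D)" by (metis QDv injI)
  \<comment> \<open>\<open>ker B = range D\<close>, because the inclusion is between subspaces of equal dimension.\<close>
  then have "dim (range ((*v) D)) = CARD('n)"
    by (simp add: dim_image_eq)
  moreover have "range ((*v) D) \<subseteq> {V. B *v V = 0}" using BDv by auto
  moreover have "subspace (range ((*v) D))"
    by (intro linear_subspace_image matrix_vector_mul_linear subspace_UNIV)
  moreover have "subspace {V. B *v V = 0}"
    by (auto simp: subspace_def algebra_simps matrix_vector_mult_scaleR)
  ultimately have ker_eq: "{V. B *v V = 0} = range ((*v) D)"
    using ker by (intro subspace_dim_equal[symmetric]) auto
  have trans: "V = 0" if "B *v V = 0" "Q *v V = 0" for V
    using that ker_eq QDv by (metis (mono_tags, lifting) imageE mem_Collect_eq matrix_vector_mult_0_right)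
  have QT: "x = 0" if "transpose Q *v x = 0" for x
  proof -
    have "x \<bullet> (Q *v (D *v x)) = (transpose Q *v x) \<bullet> (D *v x)"
      by (simp add: dot_lmul_matrix)
    then show ?thesis using that by (simp add: QDv)
  qed
  have QQT: "x = 0" if "Q *v (transpose Q *v x) = 0" for x
  proof -
    have "(transpose Q *v x) \<bullet> (transpose Q *v x) = x \<bullet> (Q *v (transpose Q *v x))"
      by (simp add: dot_lmul_matrix)
    then have "transpose Q *v x = 0" using that by (metis inner_eq_zero_iff inner_zero_right)
    then show ?thesis by (rule QT)
  qed
  have C: "?C *v V = B *v V + transpose Q *v (Q *v V)" for V
    by (simp add: matrix_vector_mult_add_rdistrib matrix_vector_mul_assoc)
  have sol: "B *v V = z \<and> Q *v V = 0" if "?C *v V = z" "Q *v z = 0" for V z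
  proof -
    have "Q *v (transpose Q *v (Q *v V)) = Q *v (?C *v V)"
      unfolding C by (simp add: matrix_vector_right_distrib QBv)
    also have "\<dots> = 0" unfolding that ..
    finally have "Q *v V = 0" by (rule QQT)
    with that(1) C[of V] show ?thesis by simp
  qed
  show inv: "invertible ?C"
  proof (rule injective_imp_invertible)
    fix V assume "?C *v V = 0"
    then have "B *v V = 0 \<and> Q *v V = 0" by (rule sol) simp
    then show "V = 0" using trans by blast
  qed
  show "B *v V = z \<and> Q *v V = 0 \<longleftrightarrow> V = matrix_inv ?C *v z" if "Q *v z = 0"
  proof
    assume "B *v V = z \<and> Q *v V = 0"
    then have "?C *v V = z" by (simp add: C)
    then have "matrix_inv ?C *v z = matrix_inv ?C *v (?C *v V)" by simp
    also have "\<dots> = V"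
      using matrix_inv_left[OF inv] by (simp only: matrix_vector_mul_assoc matrix_vector_mul_lid)
    finally show "V = matrix_inv ?C *v z" ..
  next
    assume "V = matrix_inv ?C *v z"
    then have "?C *v V = z"
      using matrix_inv_right[OF inv] by (simp only: matrix_vector_mul_assoc matrix_vector_mul_lid)
    with sol that show "B *v V = z \<and> Q *v V = 0" by blast
  qed
qed

section \<open>Derivatives, Jacobians and gradients\<close>

lemma Jac_has_derivative:
  fixes f :: "real^'a \<Rightarrow> real^'b"
  assumes "f differentiable at x"
  shows "(f has_derivative ((*v) (Jac f x))) (at x)"
  using assms jacobian_works by blast

lemma Jac_unique:
  fixes f :: "real^'a \<Rightarrow> real^'b"
  assumes "(f has_derivative (\<lambda>h. M *v h)) (at x)"
  shows "Jac f x = M"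
  using assms Jac_has_derivative[OF differentiableI[OF assms]] has_derivative_unique
  by (metis matrix_of_matrix_vector_mul)

lemma smooth_on_differentiable: "smooth_on S f \<Longrightarrow> x \<in> S \<Longrightarrow> f differentiable at x"
  unfolding smooth_on_def by (metis Ck_on.simps(2))

lemma smooth_on_frechet_derivative:
  "smooth_on S f \<Longrightarrow> smooth_on S (\<lambda>x. frechet_derivative f (at x) v)"
  unfolding smooth_on_def by (metis Ck_on.simps(2))

lemma smooth_on_imp_continuous_on: "smooth_on S f \<Longrightarrow> continuous_on S f"
  unfolding smooth_on_def by (metis Ck_on.simps(1))

lemma continuous_on_Jac:
  fixes f :: "real^'a \<Rightarrow> real^'b"
  assumes "smooth_on S f"
  shows "continuous_on S (Jac f)"
proof -
  have "continuous_on S (\<lambda>x. \<chi> i j. frechet_derivative f (at x) (axis j 1) $ i)"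
    by (intro continuous_intros continuous_on_vec_lambda smooth_on_imp_continuous_on
        smooth_on_frechet_derivative assms)
  then show ?thesis
    by (simp add: jacobian_def matrix_def)
qed

lemma grad_differentiable:
  assumes "smooth_on S f" "x \<in> S"
  shows "grad f differentiable at x"
proof -
  have "((\<lambda>y. frechet_derivative f (at y) v) differentiable at x)" for v
    using smooth_on_differentiable[OF smooth_on_frechet_derivative] assms by blast
  then show ?thesis
    by (subst differentiable_componentwise_within)
      (auto simp: grad_def[abs_def] Basis_vec_def inner_axis)
qed

lemma grad_has_derivative:
  assumes "f differentiable at x"
  shows "(f has_derivative (\<lambda>h. grad f x \<bullet> h)) (at x)"
proof -
  have 1: "(f has_derivative frechet_derivative f (at x)) (at x)"
    using assms frechet_derivative_works by blast
  then interpret linear "frechet_derivative f (at x)" by (rule has_derivative_linear)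
  have "frechet_derivative f (at x) h = grad f x \<bullet> h" for h
  proof -
    have "h = (\<Sum>j\<in>UNIV. h $ j *\<^sub>R axis j 1)"
      using basis_expansion[of h] by (simp add: scalar_mult_eq_scaleR)
    then have "frechet_derivative f (at x) h
        = frechet_derivative f (at x) (\<Sum>j\<in>UNIV. h $ j *\<^sub>R axis j 1)"
      by (rule arg_cong)
    also have "\<dots> = grad f x \<bullet> h"
      by (simp add: sum scale grad_def inner_vec_def mult.commute)
    finally show ?thesis .
  qed
  then show ?thesis using 1 by (metis ext)
qed

lemma grad_unique:
  assumes "(f has_derivative (\<lambda>h. g \<bullet> h)) (at x)"
  shows "grad f x = g"
  using grad_has_derivative[OF differentiableI[OF assms]] assms has_derivative_unique
  by (metis vector_eq_rdot)

lemma has_derivative_matrix_mult: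
  fixes Q :: "real^'b^'c"
  assumes "(f has_derivative (\<lambda>h. M *v h)) (at x)"
  shows "((\<lambda>x. Q *v f x) has_derivative (\<lambda>h. (Q ** M) *v h)) (at x)"
  using bounded_linear.has_derivative[OF matrix_vector_mul_bounded_linear assms]
  by (simp add: matrix_vector_mul_assoc)

lemma has_derivative_zero_matrix: "((\<lambda>x. 0) has_derivative (\<lambda>h. 0 *v h)) (at x)"
  by simp

lemma has_vector_derivative_at_right_iff:
  fixes G :: "real \<Rightarrow> 'a::real_normed_vector"
  shows "(G has_vector_derivative v) (at 0 within {0<..}) \<longleftrightarrow>
    ((\<lambda>\<epsilon>. (G \<epsilon> - G 0) /\<^sub>R \<epsilon>) \<longlongrightarrow> v) (at_right 0)"
proof -
  have "\<forall>\<^sub>F \<epsilon> in at_right 0. (1 / norm (\<epsilon> - 0)) *\<^sub>R (G \<epsilon> - (G 0 + (\<epsilon> - 0) *\<^sub>R v))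
      = (G \<epsilon> - G 0) /\<^sub>R \<epsilon> - v"
    using eventually_at_right_less[of "0::real"]
    by (rule eventually_mono) (simp add: algebra_simps divide_inverse)
  then show ?thesis
    unfolding has_vector_derivative_def has_derivative_within
    by (simp add: bounded_linear_scaleR_left tendsto_cong LIM_zero_iff)
qed

text \<open>First-order expansion along a curve that is only known to have a one-sided difference quotient at
  \<open>0\<close>; the curve is completed by its limit \<open>x\<close> at \<open>0\<close> so that the chain rule applies.\<close>

lemma tendsto_difference_quotient:
  fixes f :: "'a::real_normed_vector \<Rightarrow> 'b::real_normed_vector"
  assumes f: "(f has_derivative f') (at x)"
    and g: "((\<lambda>\<epsilon>. (g \<epsilon> - x) /\<^sub>R \<epsilon>) \<longlongrightarrow> v) (at_right (0::real))"
  shows "((\<lambda>\<epsilon>. (f (g \<epsilon>) - f x) /\<^sub>R \<epsilon>) \<longlongrightarrow> f' v) (at_right 0)"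
proof -
  define G where "G = g(0 := x)"
  have G: "\<forall>\<^sub>F \<epsilon> in at_right 0. g \<epsilon> = G \<epsilon>" "G 0 = x"
    using eventually_mono[OF eventually_at_right_less[of "0::real"], of "\<lambda>\<epsilon>. g \<epsilon> = G \<epsilon>"]
    by (simp_all add: G_def)
  have "((\<lambda>\<epsilon>. (G \<epsilon> - G 0) /\<^sub>R \<epsilon>) \<longlongrightarrow> v) (at_right 0)"
    using G by (intro Lim_transform_eventually[OF g]) (auto elim: eventually_mono)
  then have "(G has_vector_derivative v) (at 0 within {0<..})"
    by (simp add: has_vector_derivative_at_right_iff)
  then have "(f \<circ> G has_vector_derivative f' v) (at 0 within {0<..})"
    using f G(2) by (intro vector_derivative_diff_chain_within) (auto intro: has_derivative_at_withinI)
  then have "((\<lambda>\<epsilon>. (f (G \<epsilon>) - f (G 0)) /\<^sub>R \<epsilon>) \<longlongrightarrow> f' v) (at_right 0)"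
    by (simp add: has_vector_derivative_at_right_iff)
  then show ?thesis
    by (rule Lim_transform_eventually) (use G in \<open>auto elim: eventually_mono\<close>)
qed

text \<open>Uniformity comes from the uniform continuity of \<open>w'\<close> on \<open>[a - 1, b + 1]\<close>, which contains the
  stencils of all \<open>x \<in> [a, b]\<close> once \<open>h < 1\<close>.\<close>

lemma uniform_limit_centered_difference:
  fixes w :: "real \<Rightarrow> real^'n"
  assumes w: "smooth_on UNIV w"
  shows "uniform_limit {a..b} (\<lambda>h x. (1/h) *\<^sub>R (w (x + h/2) - w (x - h/2)))
     (\<lambda>x. vector_derivative w (at x)) (at_right 0)"
    and "continuous_on UNIV (\<lambda>x. vector_derivative w (at x))"
proof -
  let ?d = "\<lambda>x. vector_derivative w (at x)"
  have diff: "w differentiable at x" for x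
    using smooth_on_differentiable[OF w] by simp
  have wd: "(w has_vector_derivative ?d x) (at x)" for x
    using diff vector_derivative_works by blast
  have "frechet_derivative w (at x) = (\<lambda>h. h *\<^sub>R ?d x)" for x
    using wd frechet_derivative_at unfolding has_vector_derivative_def by metis
  then have "?d = (\<lambda>x. frechet_derivative w (at x) 1)" by simp
  then show cont: "continuous_on UNIV ?d"
    using smooth_on_imp_continuous_on[OF smooth_on_frechet_derivative[OF w]] by metis
  have "uniformly_continuous_on {a-1..b+1} ?d"
    by (intro compact_uniformly_continuous) (auto intro: continuous_on_subset[OF cont])
  note uc = this[unfolded uniformly_continuous_on_def, rule_format]
  show "uniform_limit {a..b} (\<lambda>h x. (1/h) *\<^sub>R (w (x + h/2) - w (x - h/2))) ?d (at_right 0)"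
  proof (rule uniform_limitI)
    fix e :: real assume "e > 0"
    then obtain d where d: "d > 0"
      "\<And>x y. x \<in> {a-1..b+1} \<Longrightarrow> y \<in> {a-1..b+1} \<Longrightarrow> dist y x < d \<Longrightarrow> dist (?d y) (?d x) < e/2"
      using uc[of "e/2"] by auto
    have "\<forall>\<^sub>F h in at_right 0. 0 < h \<and> h < min 1 d"
      using d(1) by (intro eventually_conj eventually_at_right_less)
         (auto simp: eventually_at_right intro!: exI[of _ "min 1 d"])
    then show "\<forall>\<^sub>F h in at_right 0. \<forall>x\<in>{a..b}.
        dist ((1/h) *\<^sub>R (w (x + h/2) - w (x - h/2))) (?d x) < e"
    proof (rule eventually_mono, intro ballI)
      fix h x assume h: "0 < h \<and> h < min 1 d" and x: "x \<in> {a..b}"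
      have "norm (w (x + h/2) - w (x - h/2) - ((x + h/2) - (x - h/2)) *\<^sub>R ?d x)
         \<le> norm ((x + h/2) - (x - h/2)) * (e/2)"
      proof (rule vector_differentiable_bound_linearization[where S = "{x - h/2..x + h/2}"])
        show "(w has_vector_derivative ?d y) (at y within {x - h/2..x + h/2})" for y
          using wd has_vector_derivative_at_within by blast
        show "closed_segment (x - h/2) (x + h/2) \<subseteq> {x - h/2..x + h/2}"
          using h by (simp add: closed_segment_eq_real_ivl)
        show "x \<in> {x - h/2..x + h/2}" using h by simp
        show "norm (?d y - ?d x) \<le> e/2" if "y \<in> {x - h/2..x + h/2}" for y
          using d(2)[of x y] that h x by (force simp: dist_norm)
      qed
      then have "norm (w (x + h/2) - w (x - h/2) - h *\<^sub>R ?d x) \<le> h * (e/2)"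
        using h by simp
      moreover have "(1/h) *\<^sub>R (w (x + h/2) - w (x - h/2)) - ?d x
          = (1/h) *\<^sub>R (w (x + h/2) - w (x - h/2) - h *\<^sub>R ?d x)"
        using h by (simp add: scaleR_diff_right)
      ultimately have "norm ((1/h) *\<^sub>R (w (x + h/2) - w (x - h/2)) - ?d x) \<le> (1/h) * (h * (e/2))"
        using h by (simp only: norm_scaleR) (intro mult_mono, auto)
      then show "dist ((1/h) *\<^sub>R (w (x + h/2) - w (x - h/2))) (?d x) < e"
        using h \<open>e > 0\<close> by (simp add: dist_norm)
    qed
  qed
qed

section \<open>Relaxation systems and their diffusion matrix\<close>

text \<open>The multiplier of \<open>Q\<close> in \<open>entropy_equil\<close> is left existential because the other conditions
  determine it: it is the gradient \<open>\<eta>\<close> of \<open>\<Phi> \<circ> E\<close>, see \<open>grad_entropy_Q\<close>.\<close>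

locale relaxation_system =
  fixes \<Omega> :: "(real^'N) set" and \<omega> :: "(real^'n) set"
    and F R :: "real^'N \<Rightarrow> real^'N" and Q :: "real^'N^'n"
    and E :: "real^'n \<Rightarrow> real^'N" and \<Phi> :: "real^'N \<Rightarrow> real"
  assumes open_Omega: "open \<Omega>"
    and smooth_F: "smooth_on \<Omega> F" and smooth_R: "smooth_on \<Omega> R"
    and rank_Q: "rank Q = CARD('n)"
    and QR: "V \<in> \<Omega> \<Longrightarrow> Q *v R V = 0"
    and omega_eq: "\<omega> = (\<lambda>V. Q *v V) ` \<Omega>"
    and smooth_E: "smooth_on \<omega> E"
    and E_in: "w \<in> \<omega> \<Longrightarrow> E w \<in> \<Omega>"
    and QE: "w \<in> \<omega> \<Longrightarrow> Q *v E w = w"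
    and RE: "w \<in> \<omega> \<Longrightarrow> R (E w) = 0"
    and dim_ker: "w \<in> \<omega> \<Longrightarrow> dim {V. Jac R (E w) *v V = 0} = CARD('n)"
    and QFE: "w \<in> \<omega> \<Longrightarrow> Q *v F (E w) = 0"
    and smooth_\<Phi>: "smooth_on \<Omega> \<Phi>"
    and hess_pos_def: "V \<in> \<Omega> \<Longrightarrow> pos_def_matrix (hess \<Phi> V)"
    and hess_sym: "V \<in> \<Omega> \<Longrightarrow> symmetric_matrix (hess \<Phi> V ** Jac F V)"
    and entropy_equil: "w \<in> \<omega> \<Longrightarrow> \<exists>y. grad \<Phi> (E w) = y v* Q"
begin

abbreviation "A w \<equiv> Jac F (E w)"
abbreviation "B w \<equiv> Jac R (E w)"
abbreviation "D w \<equiv> Jac E w"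
abbreviation "H w \<equiv> hess \<Phi> (E w)"
abbreviation "C w \<equiv> B w + transpose Q ** Q"
abbreviation "\<eta> \<equiv> grad (\<lambda>w. \<Phi> (E w))"

lemma open_omega: "open \<omega>"
  unfolding omega_eq using open_Omega rank_Q
  by (intro open_surjective_linear_image) (auto simp: full_rank_surjective)

lemma E_has_derivative: "w \<in> \<omega> \<Longrightarrow> (E has_derivative (*v) (D w)) (at w)"
  using smooth_E by (intro Jac_has_derivative smooth_on_differentiable)

lemma compose_E_has_derivative:
  fixes f :: "real^'N \<Rightarrow> real^'k"
  assumes "f differentiable at (E w)" "w \<in> \<omega>"
  shows "((\<lambda>w. f (E w)) has_derivative (\<lambda>h. (Jac f (E w) ** D w) *v h)) (at w)"
  using has_derivative_compose[OF E_has_derivative Jac_has_derivative] assms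
  by (simp add: matrix_vector_mul_assoc)

text \<open>Identities between functions of the equilibrium states are differentiated with this rule; it
  turns the equations that hold along the equilibrium manifold into matrix identities.\<close>

lemma derivative_eqI:
  fixes f :: "real^'n \<Rightarrow> real^'k"
  assumes "w \<in> \<omega>" "(f has_derivative (\<lambda>h. M *v h)) (at w)" "(g has_derivative (\<lambda>h. M' *v h)) (at w)"
    and "\<And>w. w \<in> \<omega> \<Longrightarrow> f w = g w"
  shows "M = M'"
  using has_derivative_transform_within_open[OF assms(2) open_omega assms(1,4)] assms(3)
  by (metis Jac_unique)

lemma Q_D: "w \<in> \<omega> \<Longrightarrow> Q ** D w = mat 1"
  by (rule derivative_eqI[OF _ has_derivative_matrix_mult[OF E_has_derivative]])
    (auto simp: QE)

lemma F_diff: "w \<in> \<omega> \<Longrightarrow> F differentiable at (E w)"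
  and R_diff: "w \<in> \<omega> \<Longrightarrow> R differentiable at (E w)"
  and \<Phi>_diff: "w \<in> \<omega> \<Longrightarrow> \<Phi> differentiable at (E w)"
  and grad_\<Phi>_diff: "w \<in> \<omega> \<Longrightarrow> grad \<Phi> differentiable at (E w)"
  using E_in smooth_F smooth_R smooth_\<Phi> smooth_on_differentiable grad_differentiable by blast+

lemma B_D: "w \<in> \<omega> \<Longrightarrow> B w ** D w = 0"
  by (rule derivative_eqI[OF _ compose_E_has_derivative[OF R_diff] has_derivative_zero_matrix])
    (auto simp: RE)

lemma Q_A_D: "w \<in> \<omega> \<Longrightarrow> Q ** (A w ** D w) = 0"
  by (rule derivative_eqI[OF _ has_derivative_matrix_mult[OF compose_E_has_derivative[OF F_diff]]
        has_derivative_zero_matrix]) (auto simp: QFE)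

lemma Q_B:
  assumes "w \<in> \<omega>"
  shows "Q ** B w = 0"
proof -
  have "((\<lambda>V. Q *v R V) has_derivative (\<lambda>h. (Q ** B w) *v h)) (at (E w))"
    by (intro has_derivative_matrix_mult Jac_has_derivative R_diff assms)
  then have "((\<lambda>V. 0) has_derivative (\<lambda>h. (Q ** B w) *v h)) (at (E w))"
    by (rule has_derivative_transform_within_open[OF _ open_Omega E_in[OF assms]]) (rule QR)
  then show ?thesis
    using Jac_unique has_derivative_zero_matrix by metis
qed

lemma invertible_H: "w \<in> \<omega> \<Longrightarrow> invertible (H w)"
  using hess_pos_def[OF E_in] unfolding pos_def_matrix_def
  by (intro injective_imp_invertible) (metis inner_zero_right less_irrefl)

lemmas invertible_C = constrained_inverse(1)[OF Q_B B_D Q_D dim_ker]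

lemma H_inv: "w \<in> \<omega> \<Longrightarrow> matrix_inv (H w) *v (H w *v x) = x"
  "w \<in> \<omega> \<Longrightarrow> H w *v (matrix_inv (H w) *v x) = x"
  using matrix_inv[OF invertible_H] by (simp_all add: matrix_vector_mul_assoc)

lemma Linv_eq:
  assumes w: "w \<in> \<omega>" and y: "Q *v (matrix_inv (H w) *v y) = 0"
  shows "Linv \<Phi> R Q E w y = matrix_inv (C w) *v (matrix_inv (H w) *v y)"
proof -
  have "Lop \<Phi> R E w *v V = y \<longleftrightarrow> B w *v V = matrix_inv (H w) *v y" for V
    unfolding Lop_def matrix_vector_mul_assoc[symmetric] using H_inv[OF w] by metis
  then show ?thesis
    unfolding Linv_def using constrained_inverse(2)[OF Q_B B_D Q_D dim_ker, OF w w w w y] by simp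
qed

text \<open>Closed form of \<open>L\<inverse>(w)\<close> on matrices with admissible columns; it makes the diffusion matrix an
  algebraic expression in continuous quantities.\<close>

lemma Linv_mat_eq:
  assumes w: "w \<in> \<omega>" and Y: "Q ** (matrix_inv (H w) ** Y) = 0"
  shows "Linv_mat \<Phi> R Q E w Y = matrix_inv (C w) ** (matrix_inv (H w) ** Y)"
proof -
  have col: "column j Z = Z *v axis j 1" for j and Z :: "real^'k^'N"
    by (simp add: matrix_vector_mult_basis)
  have "Linv \<Phi> R Q E w (column j Y) = column j (matrix_inv (C w) ** (matrix_inv (H w) ** Y))" for j
    using Y unfolding col
    by (subst Linv_eq[OF w]) (simp_all add: matrix_vector_mul_assoc matrix_mul_assoc)
  then show ?thesis
    by (simp add: Linv_mat_def vec_eq_iff column_def)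
qed

lemma diffusion_matrix_eq:
  assumes w: "w \<in> \<omega>"
  shows "diffusion_matrix \<Phi> F R Q E w = Q ** A w ** (matrix_inv (C w) ** (A w ** D w))"
proof -
  have "matrix_inv (H w) ** (H w ** A w ** D w) = A w ** D w"
    by (simp add: matrix_eq matrix_vector_mul_assoc[symmetric] H_inv w)
  then show ?thesis
    by (simp add: diffusion_matrix_def Linv_mat_eq w Q_A_D)
qed

text \<open>Continuity makes the diffusion matrix bounded along a profile on a compact interval, as the
  product of two uniform limits requires.\<close>

lemma continuous_on_diffusion_matrix: "continuous_on \<omega> (diffusion_matrix \<Phi> F R Q E)"
proof -
  note mult = bounded_bilinear.continuous_on[OF bounded_bilinear_matrix_matrix_mult]
  have comp: "continuous_on \<omega> (\<lambda>w. f (E w))" if "continuous_on \<Omega> f" for f :: "real^'N \<Rightarrow> real^'N^'N"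
    by (rule continuous_on_compose2[OF that smooth_on_imp_continuous_on[OF smooth_E]])
      (auto simp: E_in)
  note cont = comp[OF continuous_on_Jac[OF smooth_F]] comp[OF continuous_on_Jac[OF smooth_R]]
    continuous_on_Jac[OF smooth_E]
  have "continuous_on \<omega> (\<lambda>w. Q ** A w ** (matrix_inv (C w) ** (A w ** D w)))"
    by (intro mult cont continuous_on_matrix_inv continuous_on_add continuous_on_const invertible_C)
  then show ?thesis
    by (rule continuous_on_cong[THEN iffD1, rotated 2]) (simp_all add: diffusion_matrix_eq)
qed

lemma grad_entropy_E:
  assumes w: "w \<in> \<omega>"
  shows "\<eta> w = grad \<Phi> (E w) v* D w"
  using has_derivative_compose[OF E_has_derivative[OF w] grad_has_derivative[OF \<Phi>_diff[OF w]]]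
  by (intro grad_unique) (simp add: dot_lmul_matrix)

text \<open>On equilibria the entropy gradient is a combination of the rows of \<open>Q\<close>; its coefficients are the
  entropy variables \<open>\<eta>\<close> of the limit equation, since \<open>Q D = 1\<close> recovers them from the chain rule.\<close>

lemma grad_entropy_Q:
  assumes w: "w \<in> \<omega>"
  shows "grad \<Phi> (E w) = \<eta> w v* Q"
proof -
  obtain y where y: "grad \<Phi> (E w) = y v* Q" using entropy_equil[OF w] by blast
  have "\<eta> w = y"
    by (simp add: grad_entropy_E y w vector_matrix_mul_assoc Q_D)
  with y show ?thesis by simp
qed

text \<open>The entropy variables are recovered from \<open>grad \<Phi> (E v)\<close> by a left inverse of \<open>Q\<^sup>T\<close>, which may
  be taken constant, namely \<open>(D w)\<^sup>T\<close> at the base point \<open>w\<close>, so \<open>\<eta>\<close> inherits the differentiability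
  of \<open>grad \<Phi>\<close> and \<open>E\<close>. Differentiating \<open>Q\<^sup>T \<eta>(v) = grad \<Phi> (E v)\<close> gives the second
  identity.\<close>

lemma entropy_variable_derivative:
  assumes w: "w \<in> \<omega>"
  obtains N where "(\<eta> has_derivative (\<lambda>h. N *v h)) (at w)" "transpose Q ** N = H w ** D w"
proof -
  have g: "((\<lambda>v. grad \<Phi> (E v)) has_derivative (\<lambda>h. (H w ** D w) *v h)) (at w)"
    unfolding hess_def by (rule compose_E_has_derivative[OF grad_\<Phi>_diff w]) (rule w)
  have \<eta>_eq: "transpose (D w) *v grad \<Phi> (E v) = \<eta> v" if "v \<in> \<omega>" for v
    by (simp add: grad_entropy_Q that w vector_matrix_mul_assoc Q_D)
  have 1: "(\<eta> has_derivative (\<lambda>h. (transpose (D w) ** (H w ** D w)) *v h)) (at w)"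
    using has_derivative_transform_within_open[OF has_derivative_matrix_mult[OF g] open_omega w \<eta>_eq] .
  have "transpose Q ** (transpose (D w) ** (H w ** D w)) = H w ** D w"
    by (rule derivative_eqI[OF w has_derivative_matrix_mult[OF 1] g]) (simp add: grad_entropy_Q)
  with 1 show thesis by (rule that)
qed

text \<open>With \<open>N = D\<eta>\<close>, the symmetry of \<open>H\<close> and \<open>H A\<close> gives
  \<open>S\<^sup>T N = A\<^sup>T Q\<^sup>T N = A\<^sup>T H D = H A D\<close>. The matrix \<open>N\<close> is invertible because
  \<open>Q\<^sup>T N = H D\<close> is injective, so every column of \<open>S\<^sup>T\<close> is of the form
  \<open>H A D y\<close>, which is an admissible right-hand side for \<open>L\<inverse>\<close> because \<open>Q A D = 0\<close>. Then
  \<open>S L\<inverse> S\<^sup>T \<partial>\<^sub>x\<eta> = S L\<inverse> S\<^sup>T N \<partial>\<^sub>xw = Q A L\<inverse> H A D \<partial>\<^sub>xw\<close>.\<close>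

lemma limit_flux_eq:
  assumes diff: "v differentiable at x" and w: "v x \<in> \<omega>"
  shows "limit_flux \<Phi> F R Q E v x = diffusion_matrix \<Phi> F R Q E (v x) *v vector_derivative v (at x)"
proof -
  let ?w = "v x" and ?v' = "vector_derivative v (at x)"
  let ?ST = "transpose (S_mat F Q E ?w)"
  obtain N where N: "(\<eta> has_derivative (\<lambda>h. N *v h)) (at ?w)" and QN: "transpose Q ** N = H ?w ** D ?w"
    using entropy_variable_derivative[OF w] .
  have "(v has_vector_derivative ?v') (at x)"
    using diff vector_derivative_works by blast
  then have d\<eta>: "vector_derivative (\<lambda>y. \<eta> (v y)) (at x) = N *v ?v'"
    using vector_derivative_diff_chain_within[of v ?v' x UNIV \<eta>, OF _ has_derivative_at_withinI[OF N]]
    by (auto intro!: vector_derivative_at simp: o_def)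
  have sym: "transpose (A ?w) ** H ?w = H ?w ** A ?w"
    using hess_sym[OF E_in[OF w]] hess_pos_def[OF E_in[OF w]]
    by (auto simp: symmetric_matrix_def pos_def_matrix_def matrix_transpose_mul)
  have STN: "?ST *v (N *v h) = H ?w *v (A ?w *v (D ?w *v h))" for h
  proof -
    have "?ST *v (N *v h) = transpose (A ?w) *v ((transpose Q ** N) *v h)"
      by (simp add: S_mat_def matrix_transpose_mul matrix_vector_mul_assoc matrix_mul_assoc
          del: transpose_matrix_vector)
    also have "\<dots> = (transpose (A ?w) ** H ?w) *v (D ?w *v h)"
      by (simp add: QN matrix_vector_mul_assoc matrix_mul_assoc del: transpose_matrix_vector)
    finally show ?thesis
      by (simp add: sym matrix_vector_mul_assoc matrix_mul_assoc)
  qed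
  have "invertible N"
  proof (rule injective_imp_invertible)
    fix h assume "N *v h = 0"
    then have "H ?w *v (D ?w *v h) = 0"
      using QN by (metis matrix_vector_mul_assoc matrix_vector_mult_0_right)
    then have "Q *v (D ?w *v h) = 0"
      using H_inv(1)[OF w] by (metis matrix_vector_mult_0_right)
    then show "h = 0" by (simp add: matrix_vector_mul_assoc Q_D w)
  qed
  then have surj: "x = N *v (matrix_inv N *v x)" for x
    by (simp add: matrix_vector_mul_assoc matrix_inv_right)
  have surj_STN: "?ST *v h = H ?w *v (A ?w *v (D ?w *v (matrix_inv N *v h)))" for h
    using STN[of "matrix_inv N *v h"] surj[of h] by simp
  have "Q *v (matrix_inv (H ?w) *v (?ST *v h)) = 0" for h
  proof -
    have "Q *v (matrix_inv (H ?w) *v (?ST *v h))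
        = (Q ** (A ?w ** D ?w)) *v (matrix_inv N *v h)"
      unfolding surj_STN H_inv[OF w] by (simp only: matrix_vector_mul_assoc matrix_mul_assoc)
    then show ?thesis using Q_A_D[OF w] by simp
  qed
  then have "Q ** (matrix_inv (H ?w) ** ?ST) = 0"
    by (simp add: matrix_eq matrix_vector_mul_assoc[symmetric])
  note L = Linv_mat_eq[OF w this]
  have "limit_flux \<Phi> F R Q E v x
      = S_mat F Q E ?w *v (matrix_inv (C ?w) *v (matrix_inv (H ?w) *v (?ST *v (N *v ?v'))))"
    unfolding limit_flux_def L d\<eta> by (simp only: matrix_vector_mul_assoc matrix_mul_assoc)
  also have "\<dots> = diffusion_matrix \<Phi> F R Q E ?w *v ?v'"
    unfolding STN H_inv[OF w] diffusion_matrix_eq[OF w]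
    by (simp only: S_mat_def matrix_vector_mul_assoc matrix_mul_assoc)
  finally show ?thesis .
qed

text \<open>Pointwise in \<open>(t, x)\<close> the two fluxes agree on a whole neighbourhood in \<open>x\<close>, so their
  \<open>x\<close>-derivatives agree as well.\<close>

lemma solves_flux_eq_iff:
  assumes T: "open T" and v: "smooth_on T v" "v ` T \<subseteq> \<omega>"
  shows "solves_flux_eq (limit_flux \<Phi> F R Q E) T v \<longleftrightarrow>
    solves_flux_eq (\<lambda>w x. diffusion_matrix \<Phi> F R Q E (w x) *v vector_derivative w (at x)) T v"
proof -
  have "((limit_flux \<Phi> F R Q E (\<lambda>z. v (t, z))) has_vector_derivative d) (at x) \<longleftrightarrow>
    ((\<lambda>y. diffusion_matrix \<Phi> F R Q E (v (t, y)) *v vector_derivative (\<lambda>z. v (t, z)) (at y))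
      has_vector_derivative d) (at x)" if "(t, x) \<in> T" for t x d
  proof -
    have eq: "limit_flux \<Phi> F R Q E (\<lambda>z. v (t, z)) y
        = diffusion_matrix \<Phi> F R Q E (v (t, y)) *v vector_derivative (\<lambda>z. v (t, z)) (at y)"
      if y: "(t, y) \<in> T" for y
    proof (rule limit_flux_eq)
      have "(\<lambda>z. (t, z)) differentiable at y"
        by (intro differentiable_Pair) auto
      then show "(\<lambda>z. v (t, z)) differentiable at y"
        using differentiable_compose[of v "\<lambda>z. (t, z)" y UNIV] smooth_on_differentiable[OF v(1) y]
        by simp
      show "v (t, y) \<in> \<omega>" using v(2) y by auto
    qed
    have "open ((\<lambda>y. (t, y)) -` T)"
      by (intro open_vimage T continuous_intros)
    then have "\<forall>\<^sub>F y in nhds x. (t, y) \<in> T"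
      using that by (auto simp: eventually_nhds)
    then show ?thesis
      by (intro has_vector_derivative_cong_ev) (auto elim!: eventually_mono simp: eq that)
  qed
  note flux_iff = this
  show ?thesis
    unfolding solves_flux_eq_def
  proof (rule ball_cong[OF refl])
    fix p assume "p \<in> T"
    then show "(case p of (t, x) \<Rightarrow> \<exists>d. ((\<lambda>s. v (s, x)) has_vector_derivative d) (at t) \<and>
          (limit_flux \<Phi> F R Q E (\<lambda>z. v (t, z)) has_vector_derivative d) (at x)) =
      (case p of (t, x) \<Rightarrow> \<exists>d. ((\<lambda>s. v (s, x)) has_vector_derivative d) (at t) \<and>
          ((\<lambda>y. diffusion_matrix \<Phi> F R Q E (v (t, y)) *v vector_derivative (\<lambda>z. v (t, z)) (at y))
            has_vector_derivative d) (at x))"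
      by (cases p) (simp only: flux_iff prod.case)
  qed
qed

end

section \<open>Consistency of the numerical flux\<close>

context relaxation_system begin

lemma discrete_form_flux:
  assumes M: "discrete_form \<omega> (\<lambda>h. Mnum) (\<lambda>w x. diffusion_matrix \<Phi> F R Q E (w x))"
  shows "discrete_form \<omega> (\<lambda>h w. Mnum w *v ((1/h) *\<^sub>R (w 1 - w 0))) (limit_flux \<Phi> F R Q E)"
  unfolding discrete_form_def
proof (intro allI impI)
  fix w :: "real \<Rightarrow> real^'n" and a b :: real
  assume w: "smooth_on UNIV w \<and> range w \<subseteq> \<omega>"
  let ?d = "\<lambda>x. vector_derivative w (at x)"
  have diff: "w differentiable at x" for x
    using w smooth_on_differentiable by blast
  have "continuous_on {a..b} (\<lambda>x. diffusion_matrix \<Phi> F R Q E (w x))"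
    using w by (intro continuous_on_compose2[OF continuous_on_diffusion_matrix])
      (auto intro: continuous_on_subset[OF smooth_on_imp_continuous_on])
  then have bd1: "bounded ((\<lambda>x. diffusion_matrix \<Phi> F R Q E (w x)) ` {a..b})"
    by (intro compact_imp_bounded compact_continuous_image) auto
  have "continuous_on {a..b} ?d"
    using uniform_limit_centered_difference(2) w continuous_on_subset by blast
  then have bd2: "bounded (?d ` {a..b})"
    by (intro compact_imp_bounded compact_continuous_image) auto
  have "uniform_limit {a..b} (\<lambda>h x. Mnum (\<lambda>j. w (x + (of_int j - 1/2) * h)))
     (\<lambda>x. diffusion_matrix \<Phi> F R Q E (w x)) (at_right 0)"
    using M w unfolding discrete_form_def by blast
  from bounded_bilinear.bounded_uniform_limit[OF bounded_bilinear_matrix_vector_mult this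
      uniform_limit_centered_difference(1) bd2 bd1] w
  have "uniform_limit {a..b} (\<lambda>h x. Mnum (\<lambda>j. w (x + (of_int j - 1/2) * h)) *v
        ((1/h) *\<^sub>R (w (x + h/2) - w (x - h/2))))
     (\<lambda>x. diffusion_matrix \<Phi> F R Q E (w x) *v ?d x) (at_right 0)"
    by blast
  moreover have "limit_flux \<Phi> F R Q E w = (\<lambda>x. diffusion_matrix \<Phi> F R Q E (w x) *v ?d x)"
    using limit_flux_eq[OF diff] w by (intro ext) blast
  ultimately show "uniform_limit {a..b} (\<lambda>h x. Mnum (\<lambda>j. w (x + (of_int j - 1/2) * h)) *v
        ((1/h) *\<^sub>R (w (x + (of_int 1 - 1/2) * h) - w (x + (of_int 0 - 1/2) * h))))
     (limit_flux \<Phi> F R Q E w) (at_right 0)"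
    by simp
qed

end

section \<open>The limit of the scheme\<close>

lemma tendsto_alpha_mat:
  assumes "b > 0" "dx > 0" "invertible (mat 1 + sig)"
  shows "((\<lambda>\<epsilon>. alpha_mat b dx \<epsilon> sig) \<longlongrightarrow> (2 * b / dx) *\<^sub>R matrix_inv (mat 1 + sig)) (at_right 0)"
proof -
  let ?X = "(dx / (2 * b)) *\<^sub>R (mat 1 + sig)"
  have "((\<lambda>\<epsilon>. \<epsilon> *\<^sub>R mat 1 + ?X) \<longlongrightarrow> 0 *\<^sub>R mat 1 + ?X) (at_right 0)"
    by (intro tendsto_intros)
  moreover have "(\<lambda>\<epsilon>. mat \<epsilon> + ?X) = (\<lambda>\<epsilon>. \<epsilon> *\<^sub>R mat 1 + ?X)"
    by (simp add: mat_def vec_eq_iff fun_eq_iff)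
  ultimately have "((\<lambda>\<epsilon>. mat \<epsilon> + ?X) \<longlongrightarrow> ?X) (at_right 0)"
    by (simp only: scaleR_zero_left add_0)
  moreover have "invertible ?X"
    using assms by (intro scalar_invertible) auto
  ultimately have "((\<lambda>\<epsilon>. alpha_mat b dx \<epsilon> sig) \<longlongrightarrow> matrix_inv ?X) (at_right 0)"
    unfolding alpha_mat_def by (rule tendsto_matrix_inv)
  also have "matrix_inv ?X = (2 * b / dx) *\<^sub>R matrix_inv (mat 1 + sig)"
    using assms by (subst matrix_inv_scaleR) auto
  finally show ?thesis .
qed

lemma expansion_imp_tendsto:
  fixes U :: "real \<Rightarrow> 'a::real_normed_vector"
  assumes "(\<lambda>\<epsilon>. norm (U \<epsilon> - (e + \<epsilon> *\<^sub>R V))) \<in> O[at_right 0](\<lambda>\<epsilon>. \<epsilon>^2)"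
  shows "((\<lambda>\<epsilon>. (U \<epsilon> - e) /\<^sub>R \<epsilon>) \<longlongrightarrow> V) (at_right 0)" and "(U \<longlongrightarrow> e) (at_right 0)"
proof -
  obtain c where c: "\<forall>\<^sub>F \<epsilon> in at_right 0. norm (U \<epsilon> - (e + \<epsilon> *\<^sub>R V)) \<le> c * \<epsilon>^2"
    using assms by (auto elim!: landau_o.bigE)
  have pos: "\<forall>\<^sub>F \<epsilon> in at_right (0::real). 0 < \<epsilon>" by (rule eventually_at_right_less)
  have "\<forall>\<^sub>F \<epsilon> in at_right 0. norm ((U \<epsilon> - e) /\<^sub>R \<epsilon> - V) \<le> c * \<epsilon>"
    using c pos
  proof eventually_elim
    case (elim \<epsilon>)
    have "(U \<epsilon> - e) /\<^sub>R \<epsilon> - V = (U \<epsilon> - (e + \<epsilon> *\<^sub>R V)) /\<^sub>R \<epsilon>"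
      using elim by (simp add: algebra_simps)
    then have "norm ((U \<epsilon> - e) /\<^sub>R \<epsilon> - V) = norm (U \<epsilon> - (e + \<epsilon> *\<^sub>R V)) / \<epsilon>"
      using elim by (simp add: divide_inverse mult.commute)
    also have "\<dots> \<le> c * \<epsilon>"
      using elim by (simp add: divide_le_eq power2_eq_square mult.assoc)
    finally show ?case .
  qed
  moreover have "((\<lambda>\<epsilon>. c * \<epsilon>) \<longlongrightarrow> 0) (at_right 0)"
    by (rule tendsto_eq_intros refl | simp)+
  ultimately have "((\<lambda>\<epsilon>. (U \<epsilon> - e) /\<^sub>R \<epsilon> - V) \<longlongrightarrow> 0) (at_right 0)"
    by (rule Lim_null_comparison)
  then show quot: "((\<lambda>\<epsilon>. (U \<epsilon> - e) /\<^sub>R \<epsilon>) \<longlongrightarrow> V) (at_right 0)"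
    by (rule LIM_zero_cancel)
  have "((\<lambda>\<epsilon>. e + \<epsilon> *\<^sub>R ((U \<epsilon> - e) /\<^sub>R \<epsilon>)) \<longlongrightarrow> e + 0 *\<^sub>R V) (at_right 0)"
    by (intro tendsto_intros quot)
  then have "((\<lambda>\<epsilon>. e + \<epsilon> *\<^sub>R ((U \<epsilon> - e) /\<^sub>R \<epsilon>)) \<longlongrightarrow> e) (at_right 0)"
    by simp
  then show "(U \<longlongrightarrow> e) (at_right 0)"
    by (rule Lim_transform_eventually) (use pos in \<open>auto elim!: eventually_mono\<close>)
qed

context relaxation_system begin

text \<open>After division by \<open>\<epsilon>\<close> every term of the scheme converges: \<open>G\<close> below is the divided residual and
  \<open>G0\<close> its limit, in which \<open>R(U)/\<epsilon>\<close> has become \<open>B V\<close> with the first-order corrector \<open>V\<close>. Since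
  \<open>Q a\<^sub>j\<close> is a multiple of \<open>M\<^sub>j Q\<close>, multiplying by \<open>Q\<close> brings \<open>Q\<close> directly in front of each
  vector: \<open>Q B = 0\<close> removes the unknown corrector, \<open>Q F(E(u)) = 0\<close> removes the physical fluxes, and
  what remains of the HLL flux is its viscous part \<open>- b/2 (u\<^bsub>j+1\<^esub> - u\<^bsub>j\<^esub>)\<close>.\<close>

lemma scheme_limit:
  fixes sig :: "int \<Rightarrow> real^'N^'N" and M :: "int \<Rightarrow> real^'n^'n"
    and U U' :: "real \<Rightarrow> int \<Rightarrow> real^'N" and u u' :: "int \<Rightarrow> real^'n"
  assumes pos: "b > 0" "dx > 0"
    and sig: "\<And>j. invertible (mat 1 + sig j)"
      "\<And>j. Q ** matrix_inv (mat 1 + sig j) = (1 / b^2) *\<^sub>R (M j ** Q)"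
    and scheme: "\<forall>\<^sub>F \<epsilon> in at_right 0. scheme_step F R b dx dt \<epsilon> sig (U \<epsilon>) (U' \<epsilon>) i"
    and u: "\<And>j. u j \<in> \<omega>" "u' i \<in> \<omega>"
    and U: "\<And>j. ((\<lambda>\<epsilon>. U \<epsilon> j) \<longlongrightarrow> E (u j)) (at_right 0)"
    and U': "((\<lambda>\<epsilon>. U' \<epsilon> i) \<longlongrightarrow> E (u' i)) (at_right 0)"
    and U1: "((\<lambda>\<epsilon>. (U \<epsilon> i - E (u i)) /\<^sub>R \<epsilon>) \<longlongrightarrow> V) (at_right 0)"
  shows "(1/dt) *\<^sub>R (u' i - u i) =
    (1/dx^2) *\<^sub>R (M i *v (u (i + 1) - u i) + M (i - 1) *v (u (i - 1) - u i))"
proof -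
  define \<alpha> where "\<alpha> \<epsilon> j = alpha_mat b dx \<epsilon> (sig j)" for \<epsilon> j
  define a where "a j = (2 * b / dx) *\<^sub>R matrix_inv (mat 1 + sig j)" for j
  define fl where "fl j = F_HLL F b (\<lambda>j. E (u j)) j" for j
  define G where "G \<epsilon> = (1/dt) *\<^sub>R (U' \<epsilon> i - U \<epsilon> i)
        + (1/dx) *\<^sub>R (\<alpha> \<epsilon> i *v F_HLL F b (U \<epsilon>) i - \<alpha> \<epsilon> (i - 1) *v F_HLL F b (U \<epsilon>) (i - 1))
        - (1/dx) *\<^sub>R ((\<alpha> \<epsilon> i - \<alpha> \<epsilon> (i - 1)) *v F (U \<epsilon> i))
        + (1/2) *\<^sub>R ((\<alpha> \<epsilon> i + \<alpha> \<epsilon> (i - 1)) *v (R (U \<epsilon> i) /\<^sub>R \<epsilon>))" for \<epsilon>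
  define G0 where "G0 = (1/dt) *\<^sub>R (E (u' i) - E (u i))
        + (1/dx) *\<^sub>R (a i *v fl i - a (i - 1) *v fl (i - 1))
        - (1/dx) *\<^sub>R ((a i - a (i - 1)) *v F (E (u i)))
        + (1/2) *\<^sub>R ((a i + a (i - 1)) *v (B (u i) *v V))"
  note mv = bounded_bilinear.tendsto[OF bounded_bilinear_matrix_vector_mult]
  have \<alpha>: "((\<lambda>\<epsilon>. \<alpha> \<epsilon> j) \<longlongrightarrow> a j) (at_right 0)" for j
    unfolding \<alpha>_def a_def by (intro tendsto_alpha_mat pos sig)
  have FU: "((\<lambda>\<epsilon>. F (U \<epsilon> j)) \<longlongrightarrow> F (E (u j))) (at_right 0)" for j
    using differentiable_imp_continuous_within[OF F_diff[OF u(1)]] U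
    by (rule isCont_tendsto_compose)
  have fl: "((\<lambda>\<epsilon>. F_HLL F b (U \<epsilon>) j) \<longlongrightarrow> fl j) (at_right 0)" for j
    unfolding fl_def F_HLL_def by (intro tendsto_intros FU U)
  have RU: "((\<lambda>\<epsilon>. R (U \<epsilon> i) /\<^sub>R \<epsilon>) \<longlongrightarrow> B (u i) *v V) (at_right 0)"
    using tendsto_difference_quotient[OF Jac_has_derivative[OF R_diff] U1] u(1) by (simp add: RE)
  have "(G \<longlongrightarrow> G0) (at_right 0)"
    unfolding G_def G0_def by (intro tendsto_intros mv \<alpha> FU fl RU U U')
  moreover have "(G \<longlongrightarrow> 0) (at_right 0)"
  proof (rule tendsto_eventually)
    show "\<forall>\<^sub>F \<epsilon> in at_right 0. G \<epsilon> = 0"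
      using scheme eventually_at_right_less[of "0::real"]
    proof eventually_elim
      case (elim \<epsilon>)
      have "\<epsilon> *\<^sub>R G \<epsilon> = (\<epsilon> / dt) *\<^sub>R (U' \<epsilon> i - U \<epsilon> i)
          + (\<epsilon> / dx) *\<^sub>R (\<alpha> \<epsilon> i *v F_HLL F b (U \<epsilon>) i - \<alpha> \<epsilon> (i - 1) *v F_HLL F b (U \<epsilon>) (i - 1))
          - (\<epsilon> / dx) *\<^sub>R ((\<alpha> \<epsilon> i - \<alpha> \<epsilon> (i - 1)) *v F (U \<epsilon> i))
          + (1/2) *\<^sub>R ((\<alpha> \<epsilon> i + \<alpha> \<epsilon> (i - 1)) *v R (U \<epsilon> i))"
        using elim(2) unfolding G_def scaleR_add_right[of \<epsilon>] scaleR_diff_right[of \<epsilon>]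
        by (simp add: matrix_vector_mult_scaleR)
      also have "\<dots> = 0"
        using elim(1)[unfolded scheme_step_def Let_def, folded \<alpha>_def] by simp
      finally show ?case using elim(2) by simp
    qed
  qed
  ultimately have "G0 = 0"
    by (rule tendsto_unique[OF trivial_limit_at_right_real])
  have Qa: "Q *v (a j *v x) = (2 / (b * dx)) *\<^sub>R (M j *v (Q *v x))" for j x
  proof -
    have "Q *v (a j *v x) = (2 * b / dx) *\<^sub>R ((Q ** matrix_inv (mat 1 + sig j)) *v x)"
      by (simp add: a_def scaleR_matrix_vector_assoc[symmetric] matrix_vector_mult_scaleR
          matrix_vector_mul_assoc)
    then show ?thesis
      using pos by (simp add: sig(2) scaleR_matrix_vector_assoc[symmetric]
          matrix_vector_mul_assoc power2_eq_square)
  qed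
  have Qfl: "Q *v fl j = - (b/2) *\<^sub>R (u (j + 1) - u j)" for j
    by (simp add: fl_def F_HLL_def matrix_vector_mult_diff_distrib matrix_vector_right_distrib
        matrix_vector_mult_scaleR QFE QE u)
  have QB: "Q *v (B (u i) *v V) = 0"
    using Q_B[OF u(1)] by (simp add: matrix_vector_mul_assoc)
  have flux: "(1/dx) *\<^sub>R (Q *v (a j *v fl j)) = - (1/dx^2) *\<^sub>R (M j *v (u (j + 1) - u j))" for j
  proof -
    have "M j *v (Q *v fl j) = (- (b/2)) *\<^sub>R (M j *v (u (j + 1) - u j))"
      unfolding Qfl by (rule matrix_vector_mult_scaleR)
    then show ?thesis using pos by (simp add: Qa power2_eq_square)
  qed
  have "Q *v G0 = (1/dt) *\<^sub>R (u' i - u i)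
      + ((1/dx) *\<^sub>R (Q *v (a i *v fl i)) - (1/dx) *\<^sub>R (Q *v (a (i - 1) *v fl (i - 1))))"
    unfolding G0_def
    by (simp add: matrix_vector_mult_diff_distrib matrix_vector_right_distrib
        matrix_vector_mult_add_rdistrib matrix_vector_mult_diff_rdistrib
        matrix_vector_mult_scaleR scaleR_diff_right Qa QB QFE QE u)
  also have "\<dots> = (1/dt) *\<^sub>R (u' i - u i)
      - (1/dx^2) *\<^sub>R (M i *v (u (i + 1) - u i) + M (i - 1) *v (u (i - 1) - u i))"
  proof -
    have "M (i - 1) *v (u i - u (i - 1)) = - (M (i - 1) *v (u (i - 1) - u i))"
      by (simp add: matrix_vector_mult_diff_distrib)
    then show ?thesis
      unfolding flux by (simp add: scaleR_add_right)
  qed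
  finally have "Q *v G0 = (1/dt) *\<^sub>R (u' i - u i)
      - (1/dx^2) *\<^sub>R (M i *v (u (i + 1) - u i) + M (i - 1) *v (u (i - 1) - u i))" .
  then show ?thesis using \<open>G0 = 0\<close> by simp
qed

end

section \<open>Asymptotic behaviour of the scheme\<close>

theorem theorem5p2:
  fixes \<Omega> :: "(real^'N) set" and \<omega> :: "(real^'n) set"
    and F R :: "real^'N \<Rightarrow> real^'N" and Q :: "real^'N^'n"
    and E :: "real^'n \<Rightarrow> real^'N"
    and \<Phi> \<Psi> :: "real^'N \<Rightarrow> real" and \<nu> :: "real^'N \<Rightarrow> real^'n"
    and b dx dt :: real
    and sigma :: "nat \<Rightarrow> int \<Rightarrow> real^'N^'N"
    and M :: "nat \<Rightarrow> int \<Rightarrow> real^'n^'n"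
    and Mnum :: "(int \<Rightarrow> real^'n) \<Rightarrow> real^'n^'n"
    and U :: "real \<Rightarrow> nat \<Rightarrow> int \<Rightarrow> real^'N"
    and u :: "nat \<Rightarrow> int \<Rightarrow> real^'n" and U1 :: "nat \<Rightarrow> int \<Rightarrow> real^'N"
  assumes dims: "CARD('n) < CARD('N)"
    and \<Omega>: "open \<Omega>" "convex \<Omega>"
    and smooth_FR: "smooth_on \<Omega> F" "smooth_on \<Omega> R"
    and hyperbolic: "\<And>V. V \<in> \<Omega> \<Longrightarrow> real_eigenbasis (Jac F V)"
    and Q_rank: "rank Q = CARD('n)"
    and QR: "\<And>V. V \<in> \<Omega> \<Longrightarrow> Q *v R V = 0"
    and \<omega>: "\<omega> = (\<lambda>V. Q *v V) ` \<Omega>"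
    and E_smooth: "smooth_on \<omega> E"
    and E_range: "E ` \<omega> \<subseteq> \<Omega>"
    and E_equil: "\<And>w. w \<in> \<omega> \<Longrightarrow> Q *v E w = w \<and> R (E w) = 0"
    and E_unique: "\<And>w V. w \<in> \<omega> \<Longrightarrow> V \<in> \<Omega> \<Longrightarrow> Q *v V = w \<Longrightarrow> R V = 0 \<Longrightarrow> V = E w"
    and ker_dim: "\<And>w. w \<in> \<omega> \<Longrightarrow> dim {V. Jac R (E w) *v V = 0} = CARD('n)"
    and ker_im: "\<And>w. w \<in> \<omega> \<Longrightarrow>
        {V. Jac R (E w) *v V = 0} \<inter> range (\<lambda>V. Jac R (E w) *v V) = {0}"
    and QFE: "\<And>w. w \<in> \<omega> \<Longrightarrow> Q *v F (E w) = 0"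
    and \<Phi>_smooth: "smooth_on \<Omega> \<Phi>"
    and \<Phi>_pos_def: "\<And>V. V \<in> \<Omega> \<Longrightarrow> pos_def_matrix (hess \<Phi> V)"
    and \<Phi>_sym: "\<And>V. V \<in> \<Omega> \<Longrightarrow> symmetric_matrix (hess \<Phi> V ** Jac F V)"
    and \<Psi>: "\<And>V. V \<in> \<Omega> \<Longrightarrow> \<Psi> differentiable (at V)"
        "\<And>V. V \<in> \<Omega> \<Longrightarrow> grad \<Phi> V v* Jac F V = grad \<Psi> V"
    and \<Phi>_dissip: "\<And>V. V \<in> \<Omega> \<Longrightarrow> grad \<Phi> V \<bullet> R V \<ge> 0"
    and \<Phi>_equil: "\<And>w. w \<in> \<omega> \<Longrightarrow> grad \<Phi> (E w) = \<nu> (E w) v* Q"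
    and params: "b > 0" "dx > 0" "dt > 0"
    and sigma_nonsing: "\<And>n i. invertible (mat 1 + sigma n i)"
        "\<And>n i \<epsilon>. \<epsilon> > 0 \<Longrightarrow> invertible (mat (1 + dx / (2 * \<epsilon> * b)) + sigma n i)"
    and sigma_M: "\<And>n i. Q ** matrix_inv (mat 1 + sigma n i) = (1 / b^2) *\<^sub>R (M n i ** Q)"
    and M_discrete: "discrete_form \<omega> (\<lambda>h. Mnum) (\<lambda>w x. diffusion_matrix \<Phi> F R Q E (w x))"
        "\<And>n i. M n i = Mnum (\<lambda>j. u n (i + j))"
    and scheme: "\<And>n i. \<forall>\<^sub>F \<epsilon> in at_right 0.
        U \<epsilon> n i \<in> \<Omega> \<and> scheme_step F R b dx dt \<epsilon> (sigma n) (U \<epsilon> n) (U \<epsilon> (Suc n)) i"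
    and u_range: "\<And>n i. u n i \<in> \<omega>"
    and expansion: "\<And>n i. (\<lambda>\<epsilon>. norm (U \<epsilon> n i - (E (u n i) + \<epsilon> *\<^sub>R U1 n i)))
        \<in> O[at_right 0](\<lambda>\<epsilon>. \<epsilon>^2)"
  shows "(\<forall>n i. (1/dt) *\<^sub>R (u (Suc n) i - u n i) =
            (1/dx^2) *\<^sub>R (M n i *v (u n (i + 1) - u n i) + M n (i - 1) *v (u n (i - 1) - u n i)))
       \<and> discrete_form_of_flux_eq \<omega> (\<lambda>h w. Mnum w *v ((1/h) *\<^sub>R (w 1 - w 0)))
            (limit_flux \<Phi> F R Q E) dx dt u
       \<and> (\<forall>w x. w differentiable (at x) \<and> w x \<in> \<omega> \<longrightarrow>
            limit_flux \<Phi> F R Q E w x =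
              diffusion_matrix \<Phi> F R Q E (w x) *v vector_derivative w (at x))
       \<and> (\<forall>D v. open D \<and> smooth_on D v \<and> v ` D \<subseteq> \<omega> \<longrightarrow>
            (solves_flux_eq (limit_flux \<Phi> F R Q E) D v \<longleftrightarrow>
             solves_flux_eq
               (\<lambda>w x. diffusion_matrix \<Phi> F R Q E (w x) *v vector_derivative w (at x)) D v))"
proof -
  have E_in: "E w \<in> \<Omega>" and QE: "Q *v E w = w" and RE: "R (E w) = 0" and
    \<nu>: "\<exists>y. grad \<Phi> (E w) = y v* Q" if "w \<in> \<omega>" for w
    using E_range E_equil[OF that] \<Phi>_equil[OF that] that by blast+
  interpret sys: relaxation_system \<Omega> \<omega> F R Q E \<Phi>
    by (rule relaxation_system.intro[OF \<Omega>(1) smooth_FR Q_rank QR \<omega> E_smooth E_in QE RE ker_dim QFE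
          \<Phi>_smooth \<Phi>_pos_def \<Phi>_sym \<nu>])
  have step: "(1/dt) *\<^sub>R (u (Suc n) i - u n i) =
      (1/dx^2) *\<^sub>R (M n i *v (u n (i + 1) - u n i) + M n (i - 1) *v (u n (i - 1) - u n i))" for n i
    by (rule sys.scheme_limit[OF params(1,2) sigma_nonsing(1) sigma_M
          eventually_mono[OF scheme] u_range u_range expansion_imp_tendsto(2)[OF expansion]
          expansion_imp_tendsto(2)[OF expansion] expansion_imp_tendsto(1)[OF expansion]]) blast
  have "(1/dt) *\<^sub>R (u (Suc n) i - u n i) =
      (1/dx) *\<^sub>R (M n i *v ((1/dx) *\<^sub>R (u n (i + 1) - u n i))
        - M n (i - 1) *v ((1/dx) *\<^sub>R (u n i - u n (i - 1))))" for n i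
  proof -
    have "M n (i - 1) *v (u n i - u n (i - 1)) = - (M n (i - 1) *v (u n (i - 1) - u n i))"
      by (simp add: matrix_vector_mult_diff_distrib)
    then show ?thesis
      unfolding step matrix_vector_mult_scaleR
      by (simp add: scaleR_add_right power2_eq_square)
  qed
  then have "discrete_form_of_flux_eq \<omega> (\<lambda>h w. Mnum w *v ((1/h) *\<^sub>R (w 1 - w 0)))
      (limit_flux \<Phi> F R Q E) dx dt u"
    unfolding discrete_form_of_flux_eq_def
    using sys.discrete_form_flux[OF M_discrete(1)] by (simp add: M_discrete(2))
  with step show ?thesis
    using sys.limit_flux_eq sys.solves_flux_eq_iff by blast
qed

end
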